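(* Let $B\in\{1,\dots,9\}$, let $\tilde p\neq0$ be an integer and $\tilde q$ a positive integer with $\tilde q\geqslant 15\sqrt[3]{|\tilde p|}$. Put $G_4=(\sqrt2+1)\tilde q^{2}-\frac{10+7\sqrt2}{B^{2}\tilde q^{2}}$. Then the equation $\tilde Q(t)=0$ has at least one purely imaginary root $t$ with $G_4<\operatorname{Im}t<G_4-\frac{80\tilde p}{B^{3}\tilde q^{5}}$ in the case $\tilde p<0$, respectively with $G_4-\frac{80\tilde p}{B^{3}\tilde q^{5}}<\operatorname{Im}t<G_4$ in the case $\tilde p>0$.
   Context: For numbers $p,q$ let $$Q_{pq}(t)=t^{10}+(2q^{2}+p^{2})(3q^{2}-2p^{2})\,t^{8}+(q^{8}+10p^{2}q^{6}+4p^{4}q^{4}-14p^{6}q^{2}+p^{8})\,t^{6}-p^{2}q^{2}(q^{8}-14p^{2}q^{6}+4p^{4}q^{4}+10p^{6}q^{2}+p^{8})\,t^{4}-p^{6}q^{6}(q^{2}+2p^{2})(3p^{2}-2q^{2})\,t^{2}-q^{10}p^{10}.$$ Given $B$, $\tilde p$, $\tilde q$, define $\tilde Q(t)=Q_{pq}(t)$ with $p=B\tilde q^{3}-\tilde p$ and $q=\tilde q$. *)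

theory Defs
  imports "HOL-Analysis.Analysis"
begin

definition Qpq :: "'a::comm_ring_1 \<Rightarrow> 'a \<Rightarrow> 'a \<Rightarrow> 'a" where
  "Qpq p q t =
     t^10
     + (2*q^2 + p^2) * (3*q^2 - 2*p^2) * t^8
     + (q^8 + 10*p^2*q^6 + 4*p^4*q^4 - 14*p^6*q^2 + p^8) * t^6
     - p^2*q^2 * (q^8 - 14*p^2*q^6 + 4*p^4*q^4 + 10*p^6*q^2 + p^8) * t^4
     - p^6*q^6 * (q^2 + 2*p^2) * (3*p^2 - 2*q^2) * t^2
     - q^10 * p^10"

definition Qtilde :: "'a::comm_ring_1 \<Rightarrow> 'a \<Rightarrow> 'a \<Rightarrow> 'a \<Rightarrow> 'a" where
  "Qtilde B pt qt t = Qpq (B * qt^3 - pt) qt t"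

definition purely_imaginary :: "complex \<Rightarrow> bool" where
  "purely_imaginary t \<longleftrightarrow> Re t = 0 \<and> Im t \<noteq> 0"

definition G4 :: "real \<Rightarrow> real \<Rightarrow> real" where
  "G4 B qt = (sqrt 2 + 1) * qt^2 - (10 + 7 * sqrt 2) / (B^2 * qt^2)"

end

theory Submission
  imports Defs
begin

text \<open>
  On the imaginary axis put \<open>t = i q\<^sup>2 \<tau>\<close>, \<open>y = \<tau>\<^sup>2\<close> and \<open>z = q\<^sup>2 / p\<^sup>2\<close>. Up to the factor
  \<open>p\<^sup>1\<^sup>0 q\<^sup>1\<^sup>0\<close> the equation becomes \<open>scaled_Q y z = 0\<close>, a perturbation of \<open>-y\<^sup>2 + 6 y - 1 = 0\<close>, and its root
  near \<open>(1 + sqrt 2)\<^sup>2\<close> satisfies \<open>\<tau> = 1 + sqrt 2 - (10 + 7 sqrt 2) z + d z\<^sup>2 + \<dots>\<close> with \<open>d\<close> about 448.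
  A sign change locates it with \<open>d\<close> between 400 and 500. As \<open>p = B q\<^sup>3 - p'\<close>, replacing \<open>z\<close> by
  \<open>1 / (B\<^sup>2 q\<^sup>4)\<close> costs about \<open>2 (10 + 7 sqrt 2) p' / (B\<^sup>3 q\<^sup>7)\<close>, where the coefficient is about 39.8,
  and the hypothesis on \<open>q\<close> bounds the \<open>z\<^sup>2\<close>-term by \<open>34 |p'| / (B\<^sup>3 q\<^sup>7)\<close>, so the total lies
  strictly between 0 and 80 in this unit.
\<close>

definition scaled_Q :: "real \<Rightarrow> real \<Rightarrow> real" where
  "scaled_Q y z = (-(y^2) + 6*y - 1) + z * (-(y^3) - 10*y^2 - y) + z^2 * (14*y^3 - 4*y^2 - 2*y)
     + z^3 * (- 2*y^4 - 4*y^3 + 14*y^2) + z^4 * (-(y^4) - 10*y^3 - y^2) + z^5 * (-(y^5) + 6*y^4 - y^3)"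

lemma Qpq_imaginary:
  fixes p q \<tau> :: real
  assumes "p \<noteq> 0" "q \<noteq> 0"
  shows "Qpq (of_real p) (of_real q) (Complex 0 (q^2 * \<tau>)) = of_real (p^10 * q^10 * scaled_Q (\<tau>^2) (q^2 / p^2))"
proof -
  define y where "y = \<tau>^2"
  define T where "T = Complex 0 (q^2 * \<tau>)"
  have T2: "T^2 = of_real (- (q^4 * y))"
    by (simp add: T_def y_def complex_eq_iff power2_eq_square power4_eq_xxxx)
  have T4: "T^4 = (T^2)^2" and T6: "T^6 = (T^2)^3" and T8: "T^8 = (T^2)^4" and T10: "T^10 = (T^2)^5"
    by (simp_all flip: power_mult)
  have f: "p^10 * q^10 * scaled_Q y (q^2 / p^2) = q^10 * (p^10 * (-(y^2) + 6*y - 1) + p^8 * q^2 * (-(y^3) - 10*y^2 - y)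
     + p^6 * q^4 * (14*y^3 - 4*y^2 - 2*y) + p^4 * q^6 * (- 2*y^4 - 4*y^3 + 14*y^2)
     + p^2 * q^8 * (-(y^4) - 10*y^3 - y^2) + q^10 * (-(y^5) + 6*y^4 - y^3))"
  proof -
    have "p^10 * (q^2/p^2) = p^8 * q^2" "p^10 * (q^2/p^2)^2 = p^6 * q^4" "p^10 * (q^2/p^2)^3 = p^4 * q^6"
         "p^10 * (q^2/p^2)^4 = p^2 * q^8" "p^10 * (q^2/p^2)^5 = q^10"
      using assms by (simp_all add: field_simps flip: power_mult power_add)
    \<comment> \<open>Stated for an arbitrary \<open>x\<close> so that it is a polynomial identity
      within reach of \<open>algebra\<close>; the quotient \<open>q^2/p^2\<close> enters afterwards,
      and \<open>p^10\<close> clears its powers up to the fifth.\<close>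
    moreover have "p^10 * q^10 * scaled_Q y x = q^10 * (p^10 * (-(y^2) + 6*y - 1) + p^10 * x * (-(y^3) - 10*y^2 - y)
       + p^10 * x^2 * (14*y^3 - 4*y^2 - 2*y) + p^10 * x^3 * (- 2*y^4 - 4*y^3 + 14*y^2)
       + p^10 * x^4 * (-(y^4) - 10*y^3 - y^2) + p^10 * x^5 * (-(y^5) + 6*y^4 - y^3))" for x
      unfolding scaled_Q_def by algebra
    ultimately show ?thesis by (simp only:)
  qed
  have "Qpq (of_real p) (of_real q) T = of_real (q^10 * (p^10 * (-(y^2) + 6*y - 1) + p^8 * q^2 * (-(y^3) - 10*y^2 - y)
     + p^6 * q^4 * (14*y^3 - 4*y^2 - 2*y) + p^4 * q^6 * (- 2*y^4 - 4*y^3 + 14*y^2)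
     + p^2 * q^8 * (-(y^4) - 10*y^3 - y^2) + q^10 * (-(y^5) + 6*y^4 - y^3)))"
    unfolding Qpq_def T4 T6 T8 T10 T2 of_real_add of_real_mult of_real_diff of_real_minus of_real_power
      of_real_numeral of_real_1
    by algebra
  then show ?thesis
    unfolding T_def[symmetric] y_def[symmetric] f .
qed

lemma sqrt2_bounds: "1.41421 < sqrt 2" "sqrt 2 < 1.41422"
  by (rule real_less_rsqrt real_less_lsqrt; simp add: power2_eq_square)+

text \<open>The number \<open>3 + 2*w\<close> is a root of \<open>-(y^2) + 6*y - 1\<close>, and the
  slope \<open>48 + 34*w\<close> is the one for which the terms of order \<open>z\<close> cancel.
  Hence \<open>z^2\<close> factors out, and the remaining bracket decides the sign.\<close>

lemma scaled_Q_second_order: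
  fixes w z k :: real
  assumes w: "w = sqrt 2"
  defines "m \<equiv> - (48 + 34*w) + k * z"
  defines "y \<equiv> 3 + 2*w + z * m"
  shows "scaled_Q y z = z^2 * (- 4*w*k - m^2 + m * (- (y^2 + y*(3+2*w) + (3+2*w)^2) - 10*(y + 3 + 2*w) - 1)
     + (14*y^3 - 4*y^2 - 2*y) + z * (- 2*y^4 - 4*y^3 + 14*y^2) + z^2 * (-(y^4) - 10*y^3 - y^2)
     + z^3 * (-(y^5) + 6*y^4 - y^3))"
proof -
  have w2: "w^2 = 2" by (simp add: w)
  have y: "y = 3 + 2*w + z * m" by (simp add: y_def)
  have m: "m = - (48 + 34*w) + k * z" by (simp add: m_def)
  \<comment> \<open>Since \<open>algebra\<close> treats \<open>w\<close> as an indeterminate, the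
    identity carries an explicit multiple of \<open>2 - w^2\<close>, which vanishes in the next
    step. The same device recurs below.\<close>
  have "-(y^2) + 6*y - 1 = - 4*w * (z*m) - (z*m)^2 + 4 * (2 - w^2)"
    unfolding y by algebra
  then have g0: "-(y^2) + 6*y - 1 = - 4*w * (z*m) - (z*m)^2" by (simp add: w2)
  \<comment> \<open>The divided difference of \<open>-(y^3) - 10*y^2 - y\<close> between
    \<open>y\<close> and \<open>3 + 2*w\<close>.\<close>
  define h where "h = - (y^2 + y*(3+2*w) + (3+2*w)^2) - 10*(y + 3 + 2*w) - 1"
  have "-(y^3) - 10*y^2 - y = - 16 * (3+2*w)^2 + z*m * h + (3+2*w) * 4 * (2 - w^2)"
    unfolding h_def y by algebra
  then have g1: "-(y^3) - 10*y^2 - y = - 16 * (3+2*w)^2 + z*m * h" by (simp add: w2)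
  have "- 4*w * m - 16 * (3+2*w)^2 = - 4*w*k*z + 72 * (w^2 - 2)"
    unfolding m by algebra
  then have cancel: "- 4*w * m - 16 * (3+2*w)^2 = - 4*w*k*z" by (simp add: w2)
  have "scaled_Q y z = z * (- 4*w * m - 16 * (3+2*w)^2) + z^2 * (-(m^2) + m * h
     + (14*y^3 - 4*y^2 - 2*y) + z * (- 2*y^4 - 4*y^3 + 14*y^2) + z^2 * (-(y^4) - 10*y^3 - y^2)
     + z^3 * (-(y^5) + 6*y^4 - y^3))"
    unfolding scaled_Q_def g0 g1 by algebra
  then show ?thesis
    unfolding cancel h_def[symmetric] by algebra
qed

text \<open>To leading order the bracket is affine and decreasing in \<open>k\<close>, with its zero
  near 2560; 2400 and 2700 lie safely on either side. The window for \<open>k\<close> keeps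
  \<open>k * z\<close> at most 0.06, so \<open>m\<close> hardly moves.\<close>

lemma scaled_Q_sign:
  fixes z k :: real
  defines "y \<equiv> 3 + 2 * sqrt 2 - (48 + 34 * sqrt 2) * z + k * z^2"
  assumes z: "0 < z" "z \<le> 1/50000" and k: "2000 \<le> k" "k \<le> 3000"
  shows "k \<le> 2400 \<Longrightarrow> 0 < scaled_Q y z" and "2700 \<le> k \<Longrightarrow> scaled_Q y z < 0"
proof -
  define w where "w = sqrt 2"
  define m where "m = - (48 + 34*w) + k * z"
  \<comment> \<open>The negative of the \<open>h\<close> in \<open>scaled_Q_second_order\<close>:
    now \<open>-m\<close> and \<open>h\<close> are both positive and their product can be bounded
    monotonically.\<close>
  define h where "h = (y^2 + y*(3+2*w) + (3+2*w)^2) + 10*(y + 3 + 2*w) + 1"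
  define R where "R = z * (- 2*y^4 - 4*y^3 + 14*y^2) + z^2 * (-(y^4) - 10*y^3 - y^2)
     + z^3 * (-(y^5) + 6*y^4 - y^3)"
  have w: "1.41421 < w" "w < 1.41422" using sqrt2_bounds by (auto simp: w_def)
  have y: "y = 3 + 2*w + z * m"
    unfolding y_def m_def w_def by algebra
  have kz: "0 \<le> k * z" "k * z \<le> 3000 * (1/50000)"
    using z k by simp (use z k in \<open>intro mult_mono; simp\<close>)
  have m: "- 96.1 \<le> m" "m \<le> - 96" using kz w unfolding m_def by simp_all
  have zm: "z * (-m) \<le> 1/50000 * 96.1" "0 \<le> z * (-m)"
    using m z by (intro mult_mono; simp) (use m z in \<open>simp add: mult_nonneg_nonpos\<close>)
  have y_bounds: "5.826 \<le> y" "y \<le> 5.829"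
    using zm w unfolding y by simp_all
  have m2: "96^2 \<le> (-m)^2" "(-m)^2 \<le> 96.1^2"
    using m by (intro power_mono; simp)+
  have y2: "5.826^2 \<le> y^2" "y^2 \<le> 5.829^2" and y3: "5.826^3 \<le> y^3" "y^3 \<le> 5.829^3"
    and y4: "5.826^4 \<le> y^4" "y^4 \<le> 5.829^4" and y5: "5.826^5 \<le> y^5" "y^5 \<le> 5.829^5"
    using y_bounds by (intro power_mono; simp)+
  have w3: "5.828 \<le> 3+2*w" "3+2*w \<le> 5.829" using w by simp_all
  have yw: "5.826 * 5.828 \<le> y * (3+2*w)" "y * (3+2*w) \<le> 5.829 * 5.829"
    using w3 y_bounds by (intro mult_mono; simp)+
  have w32: "5.828^2 \<le> (3+2*w)^2" "(3+2*w)^2 \<le> 5.829^2"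
    using w3 by (intro power_mono; simp)+
  have h: "219 \<le> h" "h \<le> 220"
    using yw w32 y2 y_bounds w3 unfolding h_def by (simp_all add: power_numeral_reduce)
  have mh: "96 * 219 \<le> (-m) * h" "(-m) * h \<le> 96.1 * 220"
    using m h by (intro mult_mono; simp)+
  have g2: "2600 \<le> 14*y^3 - 4*y^2 - 2*y" "14*y^3 - 4*y^2 - 2*y \<le> 2650"
    using y2 y3 y_bounds by (simp_all add: power_numeral_reduce)
  have R: "\<bar>R\<bar> \<le> 1"
  proof -
    have z2: "z^2 \<le> (1/50000)^2" and z3: "z^3 \<le> (1/50000)^3"
      using z by (intro power_mono; simp)+
    have a: "\<bar>- 2*y^4 - 4*y^3 + 14*y^2\<bar> \<le> 10000" "\<bar>-(y^4) - 10*y^3 - y^2\<bar> \<le> 10000"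
      "\<bar>-(y^5) + 6*y^4 - y^3\<bar> \<le> 10000"
      using y2 y3 y4 y5 by (simp_all add: power_numeral_reduce abs_le_iff)
    have "\<bar>z * (- 2*y^4 - 4*y^3 + 14*y^2)\<bar> \<le> 1/50000 * 10000"
      "\<bar>z^2 * (-(y^4) - 10*y^3 - y^2)\<bar> \<le> (1/50000)^2 * 10000"
      "\<bar>z^3 * (-(y^5) + 6*y^4 - y^3)\<bar> \<le> (1/50000)^3 * 10000"
      unfolding abs_mult using a z z2 z3 by (intro mult_mono; simp)+
    then show ?thesis
      unfolding R_def by (simp add: power_numeral_reduce)
  qed
  define S where "S = - 4*w*k - m^2 + (-m) * h + (14*y^3 - 4*y^2 - 2*y) + R"
  have f: "scaled_Q y z = z^2 * S"
    using scaled_Q_second_order[OF w_def, of z k]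
    unfolding m_def[symmetric] y[symmetric] S_def R_def h_def by (simp add: algebra_simps)
  show "0 < scaled_Q y z" if "k \<le> 2400"
  proof -
    have "w * k \<le> 1.41422 * 2400" using w that k by (intro mult_mono) auto
    then have "0 < S"
      using m2 mh g2 R unfolding S_def by (simp add: power_numeral_reduce abs_le_iff)
    then show ?thesis using z f by simp
  qed
  show "scaled_Q y z < 0" if "2700 \<le> k"
  proof -
    have "1.41421 * 2700 \<le> w * k" using w that k by (intro mult_mono) auto
    then have "S < 0"
      using m2 mh g2 R unfolding S_def by (simp add: power_numeral_reduce abs_le_iff)
    then show ?thesis using z f by (simp add: mult_pos_neg)
  qed
qed

text \<open>Squaring \<open>\<tau>0 + K * z^2\<close> gives the form of \<open>y\<close> in
  \<open>scaled_Q_sign\<close> with coefficient \<open>k K\<close>, about 2327 for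
  \<open>K = 400\<close> and 2810 for \<open>K = 500\<close>. The intermediate value theorem then
  applies.\<close>

lemma scaled_Q_root:
  fixes z :: real
  defines "\<tau>0 \<equiv> 1 + sqrt 2 - (10 + 7 * sqrt 2) * z"
  assumes z: "0 < z" "z \<le> 1/50000"
  shows "\<exists>\<tau>. \<tau>0 + 400 * z^2 \<le> \<tau> \<and> \<tau> \<le> \<tau>0 + 500 * z^2 \<and> scaled_Q (\<tau>^2) z = 0"
proof -
  define w where "w = sqrt 2"
  define k where "k = (\<lambda>K. (10 + 7*w)^2 + 2*(1+w)*K - 2*(10+7*w)*K*z + K^2*z^2)"
  have w: "7/5 < w" "w < 71/50" using sqrt2_bounds by (auto simp: w_def)
  have w2: "w^2 = 2" by (simp add: w_def)
  have "(\<tau>0 + K * z^2)^2 = 3 + 2*w - (48 + 34*w) * z + k K * z^2 + (w^2 - 2) * (1 - 14*z)" for K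
    unfolding \<tau>0_def k_def w_def[symmetric] by algebra
  then have sq: "(\<tau>0 + K * z^2)^2 = 3 + 2 * sqrt 2 - (48 + 34 * sqrt 2) * z + k K * z^2" for K
    unfolding w2 by (simp add: w_def)
  have z2: "0 \<le> z^2" "z^2 \<le> 1/50000 * 1"
    unfolding power2_eq_square using z by simp (use z in \<open>intro mult_mono; simp\<close>)
  have wz: "0 \<le> w * z" "w * z \<le> 2 * (1/50000)"
    using w z by simp (use w z in \<open>intro mult_mono; simp\<close>)
  have "k K = 198 + 140*w + 2*K + 2*K*w - 20*K*z - 14*K*(w*z) + K*K*z^2 + 49 * (w^2 - 2)" for K
    unfolding k_def by algebra
  then have k: "k K = 198 + 140*w + 2*K + 2*K*w - 20*K*z - 14*K*(w*z) + K*K*z^2" for K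
    by (simp add: w2)
  have "2000 \<le> k 400 \<and> k 400 \<le> 2400 \<and> 2700 \<le> k 500 \<and> k 500 \<le> 3000"
    unfolding k by (intro conjI; use z z2 wz w in linarith)
  then have k400: "2000 \<le> k 400" "k 400 \<le> 2400" and k500: "2700 \<le> k 500" "k 500 \<le> 3000"
    by simp_all
  have "scaled_Q ((\<tau>0 + 500 * z^2)^2) z < 0" "0 < scaled_Q ((\<tau>0 + 400 * z^2)^2) z"
    unfolding sq using scaled_Q_sign[OF z] k400 k500 by simp_all
  moreover have "continuous_on A (\<lambda>\<tau>. scaled_Q (\<tau>^2) z)" for A
    unfolding scaled_Q_def by (intro continuous_intros)
  ultimately show ?thesis
    using IVT2'[of "\<lambda>\<tau>. scaled_Q (\<tau>^2) z" "\<tau>0 + 500 * z^2" 0 "\<tau>0 + 400 * z^2"] z2(1) by auto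
qed

text \<open>Here \<open>\<beta> = p' / (B q\<^sup>3)\<close> and \<open>v = 1 / (B\<^sup>2 q\<^sup>4)\<close>, so that \<open>z = v / (1 - \<beta>)\<^sup>2\<close>.\<close>

lemma perturbation_bounds:
  fixes \<beta> v z \<delta> :: real
  defines "c \<equiv> 10 + 7 * sqrt 2"
  assumes \<beta>: "\<bar>\<beta>\<bar> \<le> 1/3375" "\<beta> \<noteq> 0" and v: "0 < v" "v \<le> \<bar>\<beta>\<bar> / 15"
    and z: "z = v / (1 - \<beta>)^2" and \<delta>: "- c * z + 400 * z^2 \<le> \<delta>" "\<delta> \<le> - c * z + 500 * z^2"
  shows "\<beta> < 0 \<Longrightarrow> - c * v < \<delta> \<and> \<delta> < - c * v - 80 * \<beta> * v"
    and "0 < \<beta> \<Longrightarrow> - c * v - 80 * \<beta> * v < \<delta> \<and> \<delta> < - c * v"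
proof -
  define r where "r = 1 / (1 - \<beta>)^2"
  have c: "19.8 < c" "c < 20" using sqrt2_bounds by (auto simp: c_def)
  have zr: "z = v * r" by (simp add: z r_def)
  have u: "3374/3375 \<le> 1 - \<beta>" "1 - \<beta> \<le> 3376/3375" using \<beta> by (auto simp: abs_le_iff)
  have u2: "(3374/3375)^2 \<le> (1 - \<beta>)^2" "(1 - \<beta>)^2 \<le> (3376/3375)^2"
    using u by (intro power_mono; simp)+
  have r: "0.999 \<le> r" "r \<le> 1.001"
    using u2 u unfolding r_def by (auto simp: field_simps power_numeral_reduce)
  have r1: "r - 1 = \<beta> * ((2 - \<beta>) * r)"
  proof -
    have 1: "(1 - \<beta>)^2 * r = 1" using u by (simp add: r_def)
    have "r - (1 - \<beta>)^2 * r = \<beta> * ((2 - \<beta>) * r)" by algebra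
    then show ?thesis unfolding 1 .
  qed
  have s: "1.99 \<le> (2 - \<beta>) * r" "(2 - \<beta>) * r \<le> 2.01"
  proof -
    have "1.999 * 0.999 \<le> (2 - \<beta>) * r" "(2 - \<beta>) * r \<le> 2.001 * 1.001"
      using u r by (intro mult_mono; simp)+
    then show "1.99 \<le> (2 - \<beta>) * r" "(2 - \<beta>) * r \<le> 2.01" by simp_all
  qed
  \<comment> \<open>Exactly, \<open>c * z - c * v = v * \<beta> * a\<close>; to first order
    \<open>a\<close> is \<open>2 * c\<close>.\<close>
  define a where "a = c * ((2 - \<beta>) * r)"
  have a: "39 < a" "a < 41"
  proof -
    have "19.8 * 1.99 \<le> a" "a \<le> 20 * 2.01"
      using c s unfolding a_def by (intro mult_mono; simp)+
    then show "39 < a" "a < 41" by simp_all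
  qed
  \<comment> \<open>One \<open>b\<close> serves both ends, as 400 is 4/5 of 500. The bound 34 comes
    from 500/15 and the slack in \<open>r\<close>.\<close>
  define b where "b = 500 * v * r^2"
  have b: "0 < b" "b < 34 * \<bar>\<beta>\<bar>"
  proof -
    show "0 < b" using v r unfolding b_def by simp
    have "r^2 \<le> 1.001^2" using r by (intro power_mono) auto
    then have "v * r^2 \<le> \<bar>\<beta>\<bar> / 15 * 1.001^2" using v by (intro mult_mono) auto
    then have "b \<le> 500 * (\<bar>\<beta>\<bar> / 15 * 1.001^2)" unfolding b_def by simp
    then show "b < 34 * \<bar>\<beta>\<bar>" using \<beta> by (simp add: power2_eq_square)
  qed
  have cz: "c * z = c * v + v * (\<beta> * a)"
  proof -
    have "c * z = c * v + v * c * (r - 1)" unfolding zr by algebra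
    then show ?thesis unfolding r1 a_def by algebra
  qed
  have z2: "500 * z^2 = v * b" "400 * z^2 = v * (4/5 * b)"
    unfolding zr b_def by algebra+
  have lo: "- c * v + v * (4/5 * b - \<beta> * a) \<le> \<delta>" and hi: "\<delta> \<le> - c * v + v * (b - \<beta> * a)"
    using \<delta> cz z2 by (simp_all add: algebra_simps)
  \<comment> \<open>Both corrections are positive here, and 34 + 41 < 80.\<close>
  show "- c * v < \<delta> \<and> \<delta> < - c * v - 80 * \<beta> * v" if "\<beta> < 0"
  proof -
    have "\<beta> * 41 < \<beta> * a" "\<beta> * a < 0" using a that by (simp_all add: mult_neg_pos)
    then have "0 < 4/5 * b - \<beta> * a \<and> b - \<beta> * a < - 80 * \<beta>" using b that by linarith
    then have "v * 0 < v * (4/5 * b - \<beta> * a)" "v * (b - \<beta> * a) < v * (- 80 * \<beta>)"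
      using v(1) by (intro mult_strict_left_mono; simp)+
    then show ?thesis using lo hi by (simp add: algebra_simps)
  qed
  \<comment> \<open>The corrections now compete: \<open>b\<close> stays below
    \<open>34 * \<beta>\<close> while \<open>\<beta> * a\<close> exceeds
    \<open>39 * \<beta>\<close>.\<close>
  show "- c * v - 80 * \<beta> * v < \<delta> \<and> \<delta> < - c * v" if "0 < \<beta>"
  proof -
    have "\<beta> * 39 < \<beta> * a" "\<beta> * a < \<beta> * 41" using a that by simp_all
    then have "- 80 * \<beta> < 4/5 * b - \<beta> * a \<and> b - \<beta> * a < 0" using b that by linarith
    then have "v * (- 80 * \<beta>) < v * (4/5 * b - \<beta> * a)" "v * (b - \<beta> * a) < v * 0"
      using v(1) by (intro mult_strict_left_mono; simp)+
    then show ?thesis using lo hi by (simp add: algebra_simps)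
  qed
qed

theorem theorem5p1:
  fixes B pt qt :: int
  assumes "B \<in> {1..9}"
    and "pt \<noteq> 0"
    and "qt > 0"
    and "real_of_int qt \<ge> 15 * root 3 \<bar>real_of_int pt\<bar>"
  shows "(pt < 0 \<longrightarrow>
           (\<exists>t::complex. Qtilde (of_int B) (of_int pt) (of_int qt) t = 0 \<and> purely_imaginary t \<and>
              G4 (of_int B) (of_int qt) < Im t \<and>
              Im t < G4 (of_int B) (of_int qt)
                       - 80 * real_of_int pt / (real_of_int B ^ 3 * real_of_int qt ^ 5))) \<and>
         (pt > 0 \<longrightarrow>
           (\<exists>t::complex. Qtilde (of_int B) (of_int pt) (of_int qt) t = 0 \<and> purely_imaginary t \<and>
              G4 (of_int B) (of_int qt)
                - 80 * real_of_int pt / (real_of_int B ^ 3 * real_of_int qt ^ 5) < Im t \<and>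
              Im t < G4 (of_int B) (of_int qt)))"
proof -
  define b p' q :: real where "b = of_int B" and "p' = of_int pt" and "q = of_int qt"
  define p where "p = b * q^3 - p'"
  define \<beta> where "\<beta> = p' / (b * q^3)"
  define v where "v = 1 / (b^2 * q^4)"
  define z where "z = q^2 / p^2"
  define c where "c = 10 + 7 * sqrt 2"
  have b: "1 \<le> b" using assms(1) by (simp add: b_def)
  have p': "1 \<le> \<bar>p'\<bar>" using assms(2) by (simp add: p'_def)
  have root: "15 * root 3 \<bar>p'\<bar> \<le> q" using assms(4) by (simp add: p'_def q_def)
  have "1 \<le> root 3 \<bar>p'\<bar>" using p' by simp
  then have q: "15 \<le> q" using root by linarith
  have "(15 * root 3 \<bar>p'\<bar>)^3 \<le> q^3" using root by (intro power_mono) auto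
  then have q3: "3375 * \<bar>p'\<bar> \<le> q^3" by (simp add: power_mult_distrib)
  have pos: "0 < b" "0 < q" "0 < q^3" using b q by auto
  have "q^3 \<le> b * q^3" using b pos by simp
  then have bq: "3375 * \<bar>p'\<bar> \<le> b * q^3" using q3 by linarith
  have \<beta>: "\<bar>\<beta>\<bar> \<le> 1/3375" "\<beta> \<noteq> 0"
    using bq pos p' unfolding \<beta>_def by (auto simp: abs_mult field_simps)
  have v: "0 < v" "v \<le> \<bar>\<beta>\<bar> / 15"
  proof -
    show "0 < v" using pos by (simp add: v_def)
    \<comment> \<open>After clearing denominators, \<open>v \<le> \<bar>\<beta>\<bar> / 15\<close>
      says just this; it rests on the integrality of \<open>pt\<close> and \<open>B\<close>.\<close>
    have "15 * 1 * 1 \<le> q * b * \<bar>p'\<bar>" using b q p' by (intro mult_mono) auto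
    then show "v \<le> \<bar>\<beta>\<bar> / 15"
      using pos unfolding v_def \<beta>_def
      by (simp add: abs_mult field_simps power2_eq_square power3_eq_cube power4_eq_xxxx)
  qed
  have p: "p = b * q^3 * (1 - \<beta>)" using pos by (simp add: p_def \<beta>_def field_simps)
  have u: "3374/3375 \<le> 1 - \<beta>" using \<beta> by (auto simp: abs_le_iff)
  have p0: "p \<noteq> 0" using p pos u by auto
  have z: "z = v / (1 - \<beta>)^2"
    unfolding z_def v_def p power_mult_distrib using pos u by (simp add: field_simps flip: power_add power_mult)
  have z_bounds: "0 < z" "z \<le> 1/50000"
  proof -
    show "0 < z" using p0 pos by (simp add: z_def)
    have "(3374/3375)^2 \<le> (1 - \<beta>)^2" using u by (intro power_mono) auto
    \<comment> \<open>As \<open>15^4 = 50625\<close>, there is room for the factor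
      \<open>(3374/3375)^2\<close> before reaching 50000.\<close>
    moreover have "v \<le> 1/15^4"
    proof -
      have "1 * 15^4 \<le> b^2 * q^4" using b q by (intro mult_mono power_mono) (auto simp: one_le_power)
      then show ?thesis unfolding v_def using pos by (intro divide_left_mono) auto
    qed
    ultimately have "z \<le> (1/15^4) / (3374/3375)^2"
      unfolding z using v by (intro frac_le) auto
    then show "z \<le> 1/50000" by (simp add: power_numeral_reduce)
  qed
  obtain \<tau> where \<tau>: "1 + sqrt 2 - c * z + 400 * z^2 \<le> \<tau>" "\<tau> \<le> 1 + sqrt 2 - c * z + 500 * z^2"
      "scaled_Q (\<tau>^2) z = 0"
    using scaled_Q_root[OF z_bounds] unfolding c_def by blast
  define \<delta> where "\<delta> = \<tau> - (1 + sqrt 2)"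
  have \<delta>: "- c * z + 400 * z^2 \<le> \<delta>" "\<delta> \<le> - c * z + 500 * z^2"
    using \<tau> unfolding \<delta>_def by simp_all
  note bounds = perturbation_bounds[OF \<beta> v z \<delta>[unfolded c_def], folded c_def]
  have "0 < \<tau>"
  proof -
    have "c * z \<le> 20 * (1/50000)"
      using sqrt2_bounds z_bounds unfolding c_def by (intro mult_mono) auto
    moreover have "0 \<le> 400 * z^2" "0 \<le> sqrt 2" by simp_all
    ultimately show ?thesis using \<tau>(1) by linarith
  qed
  define t where "t = Complex 0 (q^2 * \<tau>)"
  have imag: "purely_imaginary t" using \<open>0 < \<tau>\<close> pos by (simp add: t_def purely_imaginary_def)
  have "Qpq (of_real p) (of_real q) t = 0"
    using Qpq_imaginary[OF p0, of q \<tau>] pos \<tau>(3) by (simp add: t_def z_def)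
  then have Q: "Qtilde (of_int B) (of_int pt) (of_int qt) t = 0"
    by (simp add: Qtilde_def p_def b_def p'_def q_def)
  \<comment> \<open>\<open>Im t\<close> and both claimed bounds are written as
    \<open>(1 + sqrt 2) * q^2\<close> plus \<open>q^2\<close> times a correction, so only the
    corrections compared in \<open>perturbation_bounds\<close> matter.\<close>
  have im: "Im t = (1 + sqrt 2) * q^2 + q^2 * \<delta>" by (simp add: t_def \<delta>_def algebra_simps)
  have G: "G4 (of_int B) (of_int qt) = (1 + sqrt 2) * q^2 + q^2 * (- c * v)"
    unfolding G4_def b_def[symmetric] q_def[symmetric] c_def[symmetric] v_def
    using pos by (simp add: field_simps flip: power_add)
  have e: "80 * real_of_int pt / (real_of_int B ^ 3 * real_of_int qt ^ 5) = q^2 * (80 * \<beta> * v)"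
    unfolding b_def[symmetric] q_def[symmetric] p'_def[symmetric] v_def \<beta>_def
    using pos by (simp add: field_simps flip: power_add power_Suc)
  have GE: "G4 (of_int B) (of_int qt) - 80 * real_of_int pt / (real_of_int B ^ 3 * real_of_int qt ^ 5)
      = (1 + sqrt 2) * q^2 + q^2 * (- c * v - 80 * \<beta> * v)"
    unfolding G e by algebra
  have q2: "0 < q^2" using pos by simp
  have "pt < 0 \<Longrightarrow> \<beta> < 0" "0 < pt \<Longrightarrow> 0 < \<beta>"
    using pos by (simp_all add: \<beta>_def p'_def divide_neg_pos)
  with bounds Q imag q2 show ?thesis
    by (intro conjI impI exI[of _ t])
      (simp_all only: GE, simp_all only: G im add_less_cancel_left mult_less_cancel_left_pos)
qed

end
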